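(* Let $\alpha\in\mathrm{Class}(0)$ and $t\in[\alpha,\alpha\omega)$. If $\alpha\in\mathrm{Lim}\{\beta\in\mathrm{Class}(0): T(0,\alpha,t)\cap\alpha\subset\beta \text{ and } \beta\le_1 g(0,\alpha,\beta)(t)\}$, then $\alpha<^0t+1$.
   Context: All variables range over ordinals; each ordinal is identified with the set of smaller ordinals, so for a set $S$ of ordinals and an ordinal $\beta$, $S\subset\beta$ means that all elements of $S$ are $<\beta$. Sums and products are ordinal operations. $\mathrm{Class}(0):=\mathbb{P}=\{\omega^\gamma:\gamma>0\}$ is the class of additive principal ordinals. For a class $A$ of ordinals, $\mathrm{Lim}\,A:=\{\alpha\neq 0:\alpha=\sup(A\cap\alpha)\}$. For $\alpha\le\beta$, $-\alpha+\beta$ is the unique $\sigma$ with $\alpha+\sigma=\beta$. The relation $<_1$. By recursion on $\beta$: $\alpha<_1\beta$ iff $\alpha<\beta$ and for every finite $Z\subset\beta$ there are a finite $\tilde Z\subset\alpha$ and a $(<,<_1,+)$-isomorphism $h:Z\to\tilde Z$ with $h(x)=x$ for all $x\in Z\cap\alpha$. Here a $(<,<_1,+)$-isomorphism $h:Z\to\tilde Z$ between sets of ordinals is a bijection such that for all $a_1,a_2\in Z$: $a_1<a_2\Leftrightarrow h(a_1)<h(a_2)$; $a_1<_1a_2\Leftrightarrow h(a_1)<_1h(a_2)$; $a_1+a_2\in Z\Leftrightarrow h(a_1)+h(a_2)\in\tilde Z$; and if $a_1+a_2\in Z$ then $h(a_1+a_2)=h(a_1)+h(a_2)$. $\alpha\le_1\beta$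 means $\alpha<_1\beta$ or $\alpha=\beta$. The maps $g(0,\alpha,c)$. For $\alpha,c\in\mathrm{Class}(0)$ with $\alpha\le c$, $g(0,\alpha,c):\alpha\omega\to c\omega$ is defined by $g(0,\alpha,c)(x)=x$ if $x<\alpha$, and $g(0,\alpha,c)(\alpha n+l)=cn+l$ for $n\in[1,\omega)$, $l<\alpha$. Moreover $g(0,c,\alpha):=g(0,\alpha,c)^{-1}$, with domain the image of $g(0,\alpha,c)$. The sets $T$. For $\alpha\in\mathrm{Class}(0)$ and $t<\alpha\omega$: $T(0,\alpha,t):=\{t\}$ if $t<\alpha$, and $T(0,\alpha,t):=\{t,-\alpha n+t\}$ if $t\in[\alpha n,\alpha n+\alpha)$ with $n\in[1,\omega)$. The relation $<^0$. For $\alpha\in\mathrm{Class}(0)$ and $t\in[\alpha,\alpha\omega]$, $\alpha<^0t$ means: $\alpha<t$ and for every finite $B\subset t$ there is $\delta\in\mathrm{Class}(0)\cap\alpha$ such that (i) $\left(\bigcup_{q\in B}T(0,\alpha,q)\right)\cap\alpha\subset\delta$, and (ii) the function $h:B\to h[B]$, $h(x):=g(0,\alpha,\delta)(x)$, is a $(<,<_1,+)$-isomorphism with $h(x)=x$ for all $x\in B\cap\alpha$. *)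

theory Defs
  imports Complex_Main
begin

section \<open>Ordinals\<close>

text \<open>
  HOL has no type of all ordinals.  The type \<open>'a ordinal\<close> is the well-ordered set of all ordinals
  below the successor cardinal of the cardinality of \<open>'a + nat\<close>.  It contains an ordinal of the
  order type of every well-order on a subset of \<open>'a + nat\<close>, so as \<open>'a\<close> varies these types exhaust
  the ordinals; it is closed under all operations used below because its cardinality is regular
  and uncountable (lemma \<open>small_bounded\<close>).  An ordinal \<open>\<beta>\<close> regarded as a set is \<open>{..<\<beta>}\<close>.
\<close>

typedef 'a ordinal = "Field (cardSuc (card_of (UNIV :: ('a + nat) set)))"
proof -
  have "\<not> finite (Field (cardSuc (card_of (UNIV :: ('a + nat) set))))"
    by (simp add: card_of_cardSuc_finite)
  then show ?thesis by (metis finite.emptyI ex_in_conv)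
qed

lemma cardSuc_UNIV_Well_order: "Well_order (cardSuc (card_of (UNIV :: ('a + nat) set)))"
  using cardSuc_Card_order[OF card_of_Card_order] card_order_on_well_order_on by blast

instantiation ordinal :: (type) wellorder
begin

definition less_eq_ordinal :: "'a ordinal \<Rightarrow> 'a ordinal \<Rightarrow> bool" where
  "x \<le> y \<longleftrightarrow> (Rep_ordinal x, Rep_ordinal y) \<in> cardSuc (card_of (UNIV :: ('a + nat) set))"

definition less_ordinal :: "'a ordinal \<Rightarrow> 'a ordinal \<Rightarrow> bool" where
  "(x :: 'a ordinal) < y \<longleftrightarrow> x \<le> y \<and> x \<noteq> y"

instance
proof
  let ?r = "cardSuc (card_of (UNIV :: ('a + nat) set))"
  have wo: "Well_order ?r" by (rule cardSuc_UNIV_Well_order)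
  then have lin: "Refl ?r" "trans ?r" "antisym ?r" "Total ?r" "wf (?r - Id)"
    by (auto simp: well_order_on_def linear_order_on_def partial_order_on_def preorder_on_def)
  fix x y z :: "'a ordinal"
  show refl: "x \<le> x"
    using lin(1) Rep_ordinal by (auto simp: less_eq_ordinal_def refl_on_def)
  show "x \<le> y \<Longrightarrow> y \<le> z \<Longrightarrow> x \<le> z"
    using lin(2) unfolding less_eq_ordinal_def by (blast dest: transD)
  have anti: "x \<le> y \<Longrightarrow> y \<le> x \<Longrightarrow> x = y" for x y :: "'a ordinal"
    using lin(3) unfolding less_eq_ordinal_def
    by (metis Rep_ordinal_inject antisymD)
  then show "x \<le> y \<Longrightarrow> y \<le> x \<Longrightarrow> x = y" .
  show "(x < y) = (x \<le> y \<and> \<not> y \<le> x)"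
    using anti refl by (auto simp: less_ordinal_def)
  show "x \<le> y \<or> y \<le> x"
    using lin(4) refl Rep_ordinal[of x] Rep_ordinal[of y]
    by (cases "x = y") (auto simp: less_eq_ordinal_def total_on_def Rep_ordinal_inject)
  fix P :: "'a ordinal \<Rightarrow> bool" and a :: "'a ordinal"
  assume step: "\<And>x. (\<And>y. y < x \<Longrightarrow> P y) \<Longrightarrow> P x"
  have "wf (inv_image (?r - Id) (Rep_ordinal :: 'a ordinal \<Rightarrow> _))"
    using lin(5) by (rule wf_inv_image)
  then show "P a"
  proof (induction a rule: wf_induct_rule)
    case (less x)
    show ?case
      by (rule step, rule less)
        (auto simp: less_ordinal_def less_eq_ordinal_def in_inv_image Rep_ordinal_inject)
  qed
qed

end

instantiation ordinal :: (type) conditionally_complete_linorder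
begin

definition inf_ordinal :: "'a ordinal \<Rightarrow> 'a ordinal \<Rightarrow> 'a ordinal" where "inf_ordinal = min"

definition sup_ordinal :: "'a ordinal \<Rightarrow> 'a ordinal \<Rightarrow> 'a ordinal" where "sup_ordinal = max"

definition Inf_ordinal :: "'a ordinal set \<Rightarrow> 'a ordinal" where
  "Inf (X :: 'a ordinal set) = (LEAST x. x \<in> X)"

definition Sup_ordinal :: "'a ordinal set \<Rightarrow> 'a ordinal" where
  "Sup (X :: 'a ordinal set) = (LEAST x. \<forall>a\<in>X. a \<le> x)"

instance
proof
  fix X :: "'a ordinal set" and x y z :: "'a ordinal"
  show "inf x y \<le> x" "inf x y \<le> y" "x \<le> sup x y" "y \<le> sup x y"
    "x \<le> y \<Longrightarrow> x \<le> z \<Longrightarrow> x \<le> inf y z" "y \<le> x \<Longrightarrow> z \<le> x \<Longrightarrow> sup y z \<le> x"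
    by (auto simp: inf_ordinal_def sup_ordinal_def)
  show "x \<in> X \<Longrightarrow> Inf X \<le> x"
    by (simp add: Inf_ordinal_def Least_le)
  show "z \<le> Inf X" if "X \<noteq> {}" and z: "\<And>x. x \<in> X \<Longrightarrow> z \<le> x"
  proof -
    from \<open>X \<noteq> {}\<close> have "\<exists>x. x \<in> X" by blast
    then have "Inf X \<in> X" unfolding Inf_ordinal_def by (rule LeastI_ex)
    then show ?thesis by (rule z)
  qed
  show "x \<le> Sup X" if "x \<in> X" "bdd_above X"
  proof -
    from \<open>bdd_above X\<close> have "\<exists>u. \<forall>a\<in>X. a \<le> u" by (simp add: bdd_above_def)
    then have "\<forall>a\<in>X. a \<le> Sup X" unfolding Sup_ordinal_def by (rule LeastI_ex)
    with \<open>x \<in> X\<close> show ?thesis by blast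
  qed
  show "X \<noteq> {} \<Longrightarrow> (\<And>x. x \<in> X \<Longrightarrow> x \<le> z) \<Longrightarrow> Sup X \<le> z"
    by (simp add: Sup_ordinal_def Least_le)
qed

end

lemma ordinal_no_top:
  fixes x :: "'a ordinal"
  shows "\<exists>z. x < z"
proof -
  let ?r = "cardSuc (card_of (UNIV :: ('a + nat) set))"
  have "\<not> finite (Field ?r)" by (simp add: card_of_cardSuc_finite)
  then obtain b where "b \<in> Field ?r" "Rep_ordinal x \<noteq> b" "(Rep_ordinal x, b) \<in> ?r"
    using infinite_Card_order_limit[OF cardSuc_Card_order[OF card_of_Card_order] _ Rep_ordinal[of x]]
    by blast
  then have "x < Abs_ordinal b"
    by (auto simp: less_ordinal_def less_eq_ordinal_def Abs_ordinal_inverse)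
  then show ?thesis ..
qed

lemma small_bounded:
  fixes A :: "'a ordinal set"
  assumes "(card_of A, card_of (UNIV :: ('a + nat) set)) \<in> ordLeq"
  shows "\<exists>b. \<forall>x\<in>A. x < b"
proof (rule ccontr)
  let ?c = "card_of (UNIV :: ('a + nat) set)"
  let ?K = "Rep_ordinal ` A"
  assume unb: "\<nexists>b. \<forall>x\<in>A. x < b"
  have "\<exists>b\<in>?K. a \<noteq> b \<and> (a, b) \<in> cardSuc ?c" if a: "a \<in> Field (cardSuc ?c)" for a
  proof -
    obtain x :: "'a ordinal" where x: "a = Rep_ordinal x"
      using a by (rule Rep_ordinal_cases)
    obtain z where "x < z" using ordinal_no_top by blast
    moreover obtain y where "y \<in> A" "z \<le> y" using unb by (meson not_le)
    ultimately have "x < y" "y \<in> A" by auto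
    then show ?thesis
      by (auto simp: x less_ordinal_def less_eq_ordinal_def Rep_ordinal_inject)
  qed
  then have "cofinal ?K (cardSuc ?c)" by (simp add: cofinal_def)
  moreover have "?K \<subseteq> Field (cardSuc ?c)" using Rep_ordinal by blast
  moreover have "regularCard (cardSuc ?c)"
    by (rule infinite_cardSuc_regularCard[OF _ card_of_Card_order]) (simp add: Field_card_of)
  ultimately have "(card_of ?K, cardSuc ?c) \<in> ordIso" by (auto simp: regularCard_def)
  moreover have "(card_of ?K, ?c) \<in> ordLeq"
    using card_of_image assms ordLeq_transitive by blast
  then have "(card_of ?K, cardSuc ?c) \<in> ordLess"
    using cardSuc_greater[OF card_of_Card_order] ordLeq_ordLess_trans by blast
  ultimately show False using not_ordLess_ordIso by blast
qed

lemma image_lessThan_bounded: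
  fixes f :: "'a ordinal \<Rightarrow> 'a ordinal"
  shows "\<exists>b. \<forall>x<a. f x < b"
proof -
  let ?c = "card_of (UNIV :: ('a + nat) set)"
  have "(card_of (underS (cardSuc ?c) (Rep_ordinal a)), cardSuc ?c) \<in> ordLess"
    by (rule card_of_underS[OF cardSuc_Card_order[OF card_of_Card_order] Rep_ordinal])
  then have small: "(card_of (underS (cardSuc ?c) (Rep_ordinal a)), ?c) \<in> ordLeq"
    by (simp only: cardSuc_ordLeq_ordLess[OF card_of_Card_order card_of_Card_order])
  have "f ` {..<a} \<subseteq> (f \<circ> Abs_ordinal) ` underS (cardSuc ?c) (Rep_ordinal a)"
  proof
    fix y assume "y \<in> f ` {..<a}"
    then obtain x where "x < a" "y = f x" by auto
    then have "Rep_ordinal x \<in> underS (cardSuc ?c) (Rep_ordinal a)"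
      by (auto simp: underS_def less_ordinal_def less_eq_ordinal_def Rep_ordinal_inject)
    with \<open>y = f x\<close> show "y \<in> (f \<circ> Abs_ordinal) ` underS (cardSuc ?c) (Rep_ordinal a)"
      by (auto intro!: image_eqI[where x = "Rep_ordinal x"] simp: Rep_ordinal_inverse)
  qed
  then have "(card_of (f ` {..<a}), ?c) \<in> ordLeq"
    by (rule ordLeq_transitive[OF card_of_mono1 ordLeq_transitive[OF card_of_image small]])
  then show ?thesis using small_bounded by blast
qed

lemma sequence_bounded:
  fixes f :: "nat \<Rightarrow> 'a ordinal"
  shows "\<exists>b. \<forall>n. f n < b"
proof -
  have "(card_of (range f), card_of (UNIV :: nat set)) \<in> ordLeq" by (rule card_of_image)
  moreover have "(card_of (UNIV :: nat set), card_of (UNIV :: ('a + nat) set)) \<in> ordLeq"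
    by (rule card_of_ordLeqI[of Inr]) auto
  ultimately have "(card_of (range f), card_of (UNIV :: ('a + nat) set)) \<in> ordLeq"
    by (rule ordLeq_transitive)
  then show ?thesis using small_bounded by blast
qed

section \<open>Ordinal arithmetic\<close>

definition osuc :: "'a ordinal \<Rightarrow> 'a ordinal" where
  "osuc x = (LEAST y. x < y)"

instantiation ordinal :: (type) "{zero, one, plus, times}"
begin

definition zero_ordinal :: "'a ordinal" where "(0 :: 'a ordinal) = (LEAST x. True)"

definition one_ordinal :: "'a ordinal" where "(1 :: 'a ordinal) = osuc 0"

text \<open>
  The recursive clauses are uniform in the second argument, as strict or non-strict suprema; the
  usual zero, successor and limit equations are derived below.
\<close>

function plus_ordinal :: "'a ordinal \<Rightarrow> 'a ordinal \<Rightarrow> 'a ordinal" where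
  "plus_ordinal a b = (LEAST x. a \<le> x \<and> (\<forall>c\<in>{..<b}. plus_ordinal a c < x))"
  by pat_completeness auto
termination by (relation "inv_image {(x, y). x < y} snd") (auto intro: wf_inv_image wf)

declare plus_ordinal.simps [simp del]

function times_ordinal :: "'a ordinal \<Rightarrow> 'a ordinal \<Rightarrow> 'a ordinal" where
  "times_ordinal a b = (LEAST x. \<forall>c\<in>{..<b}. times_ordinal a c + a \<le> x)"
  by pat_completeness auto
termination by (relation "inv_image {(x, y). x < y} snd") (auto intro: wf_inv_image wf)

declare times_ordinal.simps [simp del]

instance ..

end

definition is_limit :: "'a ordinal \<Rightarrow> bool" where
  "is_limit x \<longleftrightarrow> x \<noteq> 0 \<and> (\<forall>y<x. osuc y < x)"

definition omega :: "'a ordinal"  (\<open>\<omega>\<close>) where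
  "\<omega> = (LEAST x. is_limit x)"

function omega_pow :: "'a ordinal \<Rightarrow> 'a ordinal" where
  "omega_pow c = (LEAST x. 1 \<le> x \<and> (\<forall>d\<in>{..<c}. omega_pow d * \<omega> \<le> x))"
  by pat_completeness auto
termination by (relation "{(x, y). x < y}") (auto intro: wf_inv_image wf)

declare omega_pow.simps [simp del]

lemma ordinal_zero_le [simp]: "0 \<le> (x :: 'a ordinal)"
  unfolding zero_ordinal_def by (simp add: Least_le)

lemma ordinal_not_less_zero [simp]: "\<not> x < (0 :: 'a ordinal)"
  by (simp add: not_less)

lemma osuc_greater: "x < osuc x"
  unfolding osuc_def using ordinal_no_top by (rule LeastI_ex)

lemma osuc_least: "x < y \<Longrightarrow> osuc x \<le> y"
  unfolding osuc_def by (rule Least_le)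

lemma less_osuc_iff: "x < osuc y \<longleftrightarrow> x \<le> y"
proof
  show "x \<le> y" if "x < osuc y"
  proof (rule ccontr)
    assume "\<not> x \<le> y"
    then have "osuc y \<le> x" by (simp add: osuc_least)
    with that show False by order
  qed
  show "x < osuc y" if "x \<le> y"
    using that osuc_greater by (rule le_less_trans)
qed

lemma is_limit_pos: "is_limit x \<Longrightarrow> 0 < x"
  using ordinal_zero_le[of x] by (simp add: is_limit_def order.strict_iff_order)

lemma plus_bounds:
  fixes a b :: "'a ordinal"
  shows "a \<le> a + b \<and> (\<forall>c\<in>{..<b}. a + c < a + b)"
proof -
  obtain z where "\<forall>c<b. a + c < z" using image_lessThan_bounded by blast
  then have "a \<le> max a z \<and> (\<forall>c\<in>{..<b}. a + c < max a z)" by (auto simp: less_max_iff_disj)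
  then show ?thesis
    by (subst (1 3) plus_ordinal.simps) (rule LeastI)
qed

lemma plus_le: "a \<le> x \<Longrightarrow> (\<And>c. c < b \<Longrightarrow> a + c < x) \<Longrightarrow> a + b \<le> (x :: 'a ordinal)"
  by (subst plus_ordinal.simps) (rule Least_le, simp)

lemma plus_strict_mono: "c < b \<Longrightarrow> a + c < a + (b :: 'a ordinal)"
  using plus_bounds[of a b] by simp

lemma plus_mono_right:
  assumes "c \<le> b"
  shows "a + c \<le> a + (b :: 'a ordinal)"
proof (cases "c = b")
  case False
  with assms have "c < b" by order
  then show ?thesis by (intro less_imp_le plus_strict_mono)
qed simp

lemma plus_mono_left: "a \<le> a' \<Longrightarrow> a + c \<le> a' + (c :: 'a ordinal)"
proof (induction c rule: less_induct)
  case (less c)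
  show ?case
  proof (rule plus_le)
    show "a \<le> a' + c"
      using less.prems plus_bounds[of a' c] by (meson order_trans)
    show "a + d < a' + c" if "d < c" for d
      using less.IH[OF that less.prems] plus_strict_mono[OF that, of a'] by (rule le_less_trans)
  qed
qed

lemma plus_zero: "a + 0 = (a :: 'a ordinal)"
proof (rule antisym)
  show "a + 0 \<le> a" by (rule plus_le) simp_all
  show "a \<le> a + 0" using plus_bounds by blast
qed

lemma plus_osuc: "a + osuc b = osuc (a + b)"
proof (rule antisym)
  show "a + osuc b \<le> osuc (a + b)"
  proof (rule plus_le)
    show "a \<le> osuc (a + b)"
      using plus_bounds[of a b] osuc_greater[of "a + b"] by (meson less_imp_le order_trans)
    show "a + c < osuc (a + b)" if "c < osuc b" for c
      using that by (simp add: less_osuc_iff plus_mono_right)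
  qed
  show "osuc (a + b) \<le> a + osuc b"
    by (intro osuc_least plus_strict_mono osuc_greater)
qed

lemma le_plus_right: "x \<le> a + (x :: 'a ordinal)"
proof (induction x rule: less_induct)
  case (less x)
  show ?case
  proof (rule ccontr)
    assume "\<not> x \<le> a + x"
    then have "a + x < x" by simp
    then have "a + x \<le> a + (a + x)" "a + (a + x) < a + x"
      using less plus_strict_mono by blast+
    then show False by order
  qed
qed

lemma plus_limit:
  assumes "is_limit b"
  shows "a + b = Sup ((\<lambda>c. a + c) ` {..<b})"
proof (rule antisym)
  have ne: "{..<b} \<noteq> {}" using is_limit_pos[OF assms] by blast
  have bdd: "bdd_above ((\<lambda>c. a + c) ` {..<b})"
    by (rule bdd_aboveI2[of _ _ "a + b"]) (auto intro: less_imp_le plus_strict_mono)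
  show "a + b \<le> Sup ((\<lambda>c. a + c) ` {..<b})"
  proof (rule plus_le)
    obtain c where "c < b" using ne by auto
    then show "a \<le> Sup ((\<lambda>c. a + c) ` {..<b})"
      using cSup_upper[OF _ bdd, of "a + c"] plus_bounds[of a c] by fastforce
    fix c assume "c < b"
    then have "osuc c < b" using assms by (auto simp: is_limit_def)
    then have "a + osuc c \<le> Sup ((\<lambda>c. a + c) ` {..<b})"
      by (intro cSup_upper[OF _ bdd]) auto
    then show "a + c < Sup ((\<lambda>c. a + c) ` {..<b})"
      using osuc_greater[of c] plus_strict_mono[of c "osuc c" a] by auto
  qed
  show "Sup ((\<lambda>c. a + c) ` {..<b}) \<le> a + b"
    using ne by (intro cSup_least) (auto intro: less_imp_le plus_strict_mono)
qed

lemma plus_one: "a + 1 = osuc a"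
  unfolding one_ordinal_def plus_osuc plus_zero by (rule refl)

lemma times_bounds:
  fixes a b :: "'a ordinal"
  shows "\<forall>c\<in>{..<b}. a * c + a \<le> a * b"
proof -
  obtain z where "\<forall>c<b. a * c + a < z"
    using image_lessThan_bounded[of b "\<lambda>c. a * c + a"] by blast
  then have "\<forall>c\<in>{..<b}. a * c + a \<le> z" by (auto intro: less_imp_le)
  then have "\<forall>c\<in>{..<b}. a * c + a \<le> (LEAST x. \<forall>c\<in>{..<b}. a * c + a \<le> x)"
    by (rule LeastI)
  then show ?thesis by (simp only: times_ordinal.simps[of a b, symmetric])
qed

lemma times_le: "(\<And>c. c < b \<Longrightarrow> a * c + a \<le> x) \<Longrightarrow> a * b \<le> (x :: 'a ordinal)"
  by (subst times_ordinal.simps) (rule Least_le, simp)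

lemma times_mono_right: "c \<le> b \<Longrightarrow> a * c \<le> a * (b :: 'a ordinal)"
proof (rule times_le)
  show "a * d + a \<le> a * b" if "c \<le> b" "d < c" for d
    using that times_bounds[of b a] by simp
qed

lemma times_mono_left: "a \<le> a' \<Longrightarrow> a * c \<le> a' * (c :: 'a ordinal)"
proof (induction c rule: less_induct)
  case (less c)
  show ?case
  proof (rule times_le)
    fix d assume "d < c"
    then have "a * d + a \<le> a' * d + a" using less plus_mono_left by blast
    also have "\<dots> \<le> a' * d + a'"
      using less.prems by (rule plus_mono_right)
    also have "\<dots> \<le> a' * c" using times_bounds[of c a'] \<open>d < c\<close> by simp
    finally show "a * d + a \<le> a' * c" .
  qed
qed

lemma times_zero: "a * 0 = (0 :: 'a ordinal)"
  by (rule antisym, rule times_le) simp_all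

lemma times_osuc: "a * osuc b = a * b + a"
proof (rule antisym)
  show "a * osuc b \<le> a * b + a"
    by (rule times_le) (auto simp: less_osuc_iff intro: plus_mono_left times_mono_right)
  show "a * b + a \<le> a * osuc b"
    using times_bounds[of "osuc b" a] osuc_greater[of b] by simp
qed

lemma times_limit:
  assumes "is_limit b"
  shows "a * b = Sup ((\<lambda>c. a * c) ` {..<b})"
proof (rule antisym)
  have ne: "{..<b} \<noteq> {}" using is_limit_pos[OF assms] by blast
  have bdd: "bdd_above ((\<lambda>c. a * c) ` {..<b})"
    by (rule bdd_aboveI2[of _ _ "a * b"]) (auto intro: times_mono_right less_imp_le)
  show "a * b \<le> Sup ((\<lambda>c. a * c) ` {..<b})"
  proof (rule times_le)
    fix c assume "c < b"
    then have "osuc c < b" using assms by (auto simp: is_limit_def)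
    then show "a * c + a \<le> Sup ((\<lambda>c. a * c) ` {..<b})"
      unfolding times_osuc[symmetric] by (intro cSup_upper[OF _ bdd]) auto
  qed
  show "Sup ((\<lambda>c. a * c) ` {..<b}) \<le> a * b"
    using ne by (intro cSup_least) (auto intro: times_mono_right less_imp_le)
qed

lemma is_limit_omega: "is_limit (\<omega> :: 'a ordinal)"
proof -
  define f :: "nat \<Rightarrow> 'a ordinal" where "f n = (osuc ^^ n) 0" for n
  define l where "l = (LEAST b. \<forall>n. f n < b)"
  have l: "f n < l" for n
    using LeastI_ex[OF sequence_bounded[of f]] by (simp add: l_def)
  have "osuc y < l" if "y < l" for y
  proof -
    have "\<not> (\<forall>n. f n < y)" using that unfolding l_def by (rule not_less_Least)
    then obtain n where "y \<le> f n" by (auto simp: not_less)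
    then have "osuc y \<le> f (Suc n)"
      using osuc_least[of y "f (Suc n)"] by (simp add: f_def less_osuc_iff)
    then show ?thesis using l le_less_trans by blast
  qed
  moreover have "l \<noteq> 0" using l[of 0] by (auto simp: f_def)
  ultimately have "is_limit l" by (simp add: is_limit_def)
  then show ?thesis unfolding omega_def by (rule LeastI)
qed

lemma not_limit_below_omega: "x < \<omega> \<Longrightarrow> \<not> is_limit x"
  unfolding omega_def by (rule not_less_Least)

lemma omega_pow_bounds:
  "1 \<le> omega_pow c \<and> (\<forall>d\<in>{..<c}. omega_pow d * \<omega> \<le> omega_pow c)"
proof -
  obtain z where "\<forall>d<c. omega_pow d * \<omega> < z"
    using image_lessThan_bounded[of c "\<lambda>d. omega_pow d * \<omega>"] by blast
  then have "1 \<le> max 1 z \<and> (\<forall>d\<in>{..<c}. omega_pow d * \<omega> \<le> max 1 z)"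
    by (auto simp: le_max_iff_disj less_imp_le)
  then have "1 \<le> (LEAST x. 1 \<le> x \<and> (\<forall>d\<in>{..<c}. omega_pow d * \<omega> \<le> x)) \<and>
      (\<forall>d\<in>{..<c}. omega_pow d * \<omega> \<le> (LEAST x. 1 \<le> x \<and> (\<forall>d\<in>{..<c}. omega_pow d * \<omega> \<le> x)))"
    by (rule LeastI)
  then show ?thesis unfolding omega_pow.simps[of c, symmetric] .
qed

lemma omega_pow_le:
  "1 \<le> x \<Longrightarrow> (\<And>d. d < c \<Longrightarrow> omega_pow d * \<omega> \<le> x) \<Longrightarrow> omega_pow c \<le> x"
  by (subst omega_pow.simps) (rule Least_le, simp)

lemma omega_pow_mono: "d \<le> c \<Longrightarrow> omega_pow d \<le> omega_pow c"
proof (rule omega_pow_le)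
  show "1 \<le> omega_pow c" using omega_pow_bounds by blast
  show "omega_pow e * \<omega> \<le> omega_pow c" if "d \<le> c" "e < d" for e
    using that omega_pow_bounds[of c] by simp
qed

lemma omega_pow_zero: "omega_pow 0 = 1"
proof (rule antisym)
  show "omega_pow 0 \<le> 1" by (rule omega_pow_le) simp_all
  show "1 \<le> omega_pow 0" using omega_pow_bounds by blast
qed

lemma omega_pow_osuc: "omega_pow (osuc c) = omega_pow c * \<omega>"
proof (rule antisym)
  have "0 < (\<omega> :: 'a ordinal)" using is_limit_omega by (rule is_limit_pos)
  then have "osuc 0 \<le> (\<omega> :: 'a ordinal)" by (rule osuc_least)
  have "omega_pow c \<le> omega_pow c * osuc 0"
    by (simp add: times_osuc times_zero le_plus_right)
  also have "\<dots> \<le> omega_pow c * \<omega>" using \<open>osuc 0 \<le> \<omega>\<close> by (rule times_mono_right)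
  finally have "1 \<le> omega_pow c * \<omega>" using omega_pow_bounds order_trans by blast
  then show "omega_pow (osuc c) \<le> omega_pow c * \<omega>"
    by (rule omega_pow_le) (auto simp: less_osuc_iff intro: times_mono_left omega_pow_mono)
  show "omega_pow c * \<omega> \<le> omega_pow (osuc c)"
    using omega_pow_bounds[of "osuc c"] osuc_greater[of c] by simp
qed

lemma omega_pow_limit:
  assumes "is_limit c"
  shows "omega_pow c = Sup (omega_pow ` {..<c})"
proof (rule antisym)
  have ne: "0 < c" using assms by (rule is_limit_pos)
  have bdd: "bdd_above (omega_pow ` {..<c})"
    by (rule bdd_aboveI2[of _ _ "omega_pow c"]) (auto intro: omega_pow_mono less_imp_le)
  show "omega_pow c \<le> Sup (omega_pow ` {..<c})"
  proof (rule omega_pow_le)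
    show "1 \<le> Sup (omega_pow ` {..<c})"
      using ne by (intro cSup_upper[OF _ bdd]) (auto simp: omega_pow_zero intro!: image_eqI[of _ _ 0])
    fix d assume "d < c"
    then have "osuc d < c" using assms by (auto simp: is_limit_def)
    then show "omega_pow d * \<omega> \<le> Sup (omega_pow ` {..<c})"
      unfolding omega_pow_osuc[symmetric] by (intro cSup_upper[OF _ bdd]) auto
  qed
  show "Sup (omega_pow ` {..<c}) \<le> omega_pow c"
    using ne by (intro cSup_least) (auto intro: omega_pow_mono less_imp_le)
qed

text \<open>\<open>left_diff a b\<close> is \<open>- a + b\<close>, meaningful for \<open>a \<le> b\<close>.\<close>

definition left_diff :: "'a ordinal \<Rightarrow> 'a ordinal \<Rightarrow> 'a ordinal" where
  "left_diff a b = (THE s. a + s = b)"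

lemma left_diff_ex1:
  fixes a b :: "'a ordinal"
  assumes "a \<le> b"
  shows "\<exists>!s. a + s = b"
proof (rule ex_ex1I)
  have ex: "\<exists>s. b \<le> a + s" using le_plus_right by blast
  define s where "s = (LEAST s. b \<le> a + s)"
  have "b \<le> a + s" using LeastI_ex[OF ex] by (simp add: s_def)
  moreover have "a + s \<le> b"
  proof (rule plus_le)
    show "a + c < b" if "c < s" for c
      using not_less_Least[OF that[unfolded s_def]] by simp
  qed (rule assms)
  ultimately show "\<exists>s. a + s = b" by (blast intro: antisym)
  show "a + x = b \<Longrightarrow> a + y = b \<Longrightarrow> x = y" for x y
    by (metis less_irrefl neqE plus_strict_mono)
qed

definition Lim_pts :: "'a ordinal set \<Rightarrow> 'a ordinal set" where
  "Lim_pts A = {\<alpha>. \<alpha> \<noteq> 0 \<and> \<alpha> = Sup (A \<inter> {..<\<alpha>})}"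

lemma Sup_ordinal_empty: "Sup {} = (0 :: 'a ordinal)"
  by (simp add: Sup_ordinal_def zero_ordinal_def)

definition Class0 :: "'a ordinal set" where
  "Class0 = {omega_pow \<gamma> | \<gamma>. 0 < \<gamma>}"

section \<open>The relation \<open><\<^sub>1\<close>\<close>

text \<open>\<open>ord_iso R h Z Z'\<close>: the map \<open>h\<close> is a \<open>(<, R, +)\<close>-isomorphism from \<open>Z\<close> to \<open>Z'\<close>.\<close>

definition ord_iso ::
  "('a ordinal \<Rightarrow> 'a ordinal \<Rightarrow> bool) \<Rightarrow> ('a ordinal \<Rightarrow> 'a ordinal)
    \<Rightarrow> 'a ordinal set \<Rightarrow> 'a ordinal set \<Rightarrow> bool" where
  "ord_iso R h Z Z' \<longleftrightarrow> bij_betw h Z Z' \<and>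
    (\<forall>a\<in>Z. \<forall>b\<in>Z.
      (a < b \<longleftrightarrow> h a < h b) \<and>
      (R a b \<longleftrightarrow> R (h a) (h b)) \<and>
      (a + b \<in> Z \<longleftrightarrow> h a + h b \<in> Z') \<and>
      (a + b \<in> Z \<longrightarrow> h (a + b) = h a + h b))"

lemma ord_iso_cong [fundef_cong]:
  assumes "h = h'" "Z = Y" "Z' = Y'" "\<And>a b. b \<in> Y \<union> Y' \<Longrightarrow> R a b = S a b"
  shows "ord_iso R h Z Z' = ord_iso S h' Y Y'"
  unfolding ord_iso_def assms(1-3) using assms(4)
  by (intro conj_cong refl ball_cong) (auto dest: bij_betwE)

context
  notes conj_cong [fundef_cong]
begin

function less1 :: "'a ordinal \<Rightarrow> 'a ordinal \<Rightarrow> bool"  (infix \<open><\<^sub>1\<close> 50) where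
  "\<alpha> <\<^sub>1 \<beta> \<longleftrightarrow> \<alpha> < \<beta> \<and>
    (\<forall>Z. Z \<subseteq> {..<\<beta>} \<and> finite Z \<longrightarrow>
      (\<exists>Z' h. Z' \<subseteq> {..<\<alpha>} \<and> finite Z' \<and> ord_iso (\<lambda>a b. a <\<^sub>1 b) h Z Z' \<and>
        (\<forall>x \<in> Z \<inter> {..<\<alpha>}. h x = x)))"
  by pat_completeness auto
termination
  by (relation "inv_image {(x, y). x < y} snd") (auto intro: wf)

declare less1.simps [simp del]

end

definition le1 :: "'a ordinal \<Rightarrow> 'a ordinal \<Rightarrow> bool"  (infix \<open>\<le>\<^sub>1\<close> 50) where
  "\<alpha> \<le>\<^sub>1 \<beta> \<longleftrightarrow> \<alpha> <\<^sub>1 \<beta> \<or> \<alpha> = \<beta>"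

section \<open>The maps \<open>g(0, \<alpha>, c)\<close>, the sets \<open>T(0, \<alpha>, t)\<close> and the relation \<open><\<^sup>0\<close>\<close>

text \<open>
  \<open>g_up \<alpha> c\<close> is \<open>g(0, \<alpha>, c)\<close> for \<open>\<alpha> \<le> c\<close>, as a map on the domain \<open>{..<\<alpha> * \<omega>}\<close>.  For \<open>c < \<alpha>\<close> the
  map \<open>g0 \<alpha> c\<close> is the inverse of \<open>g_up c \<alpha>\<close>, with domain \<open>g_up c \<alpha> ` {..<c * \<omega>}\<close>.  Values outside
  these domains are junk.  They are never used below: an ordinal \<open>x < \<alpha> * \<omega>\<close> lies in the domain of
  \<open>g0 \<alpha> \<delta>\<close>, \<open>\<delta> < \<alpha>\<close>, iff \<open>T0 \<alpha> x \<inter> {..<\<alpha>} \<subseteq> {..<\<delta>}\<close>.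
  All of this is intended for \<open>\<alpha>, c, \<delta> \<in> Class0\<close>, and \<open>\<alpha> <\<^sup>0 t\<close> for \<open>t \<in> {\<alpha>..\<alpha> * \<omega>}\<close>.
\<close>

definition g_up :: "'a ordinal \<Rightarrow> 'a ordinal \<Rightarrow> 'a ordinal \<Rightarrow> 'a ordinal" where
  "g_up \<alpha> c x =
    (if x < \<alpha> then x
     else THE y. \<exists>n l. 1 \<le> n \<and> n < \<omega> \<and> l < \<alpha> \<and> x = \<alpha> * n + l \<and> y = c * n + l)"

definition g0 :: "'a ordinal \<Rightarrow> 'a ordinal \<Rightarrow> 'a ordinal \<Rightarrow> 'a ordinal" where
  "g0 \<alpha> c = (if \<alpha> \<le> c then g_up \<alpha> c else inv_into {..<c * \<omega>} (g_up c \<alpha>))"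

definition T0 :: "'a ordinal \<Rightarrow> 'a ordinal \<Rightarrow> 'a ordinal set" where
  "T0 \<alpha> t =
    (if t < \<alpha> then {t}
     else {t} \<union> {left_diff (\<alpha> * n) t | n. 1 \<le> n \<and> n < \<omega> \<and> t \<in> {\<alpha> * n..<\<alpha> * n + \<alpha>}})"

definition less0 :: "'a ordinal \<Rightarrow> 'a ordinal \<Rightarrow> bool"  (infix \<open><\<^sup>0\<close> 50) where
  "\<alpha> <\<^sup>0 t \<longleftrightarrow> \<alpha> < t \<and>
    (\<forall>B. finite B \<and> B \<subseteq> {..<t} \<longrightarrow>
      (\<exists>\<delta> \<in> Class0 \<inter> {..<\<alpha>}.
        (\<Union>q\<in>B. T0 \<alpha> q) \<inter> {..<\<alpha>} \<subseteq> {..<\<delta>} \<and>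
        ord_iso (<\<^sub>1) (g0 \<alpha> \<delta>) B (g0 \<alpha> \<delta> ` B) \<and>
        (\<forall>x \<in> B \<inter> {..<\<alpha>}. g0 \<alpha> \<delta> x = x)))"

end

theory Submission
  imports Defs
begin

text \<open>
  By induction on \<open>u \<in> (\<alpha>, t + 1]\<close> one shows \<open>\<alpha> <\<^sup>0 u\<close>.  Given a finite \<open>B \<subset> u\<close>, choose \<open>\<delta> < \<alpha>\<close>
  with \<open>\<delta> \<le>\<^sub>1 g(0, \<alpha>, \<delta>)(t)\<close> so large that it exceeds all remainders modulo \<open>\<alpha>\<close> of elements of \<open>B\<close>
  and that \<open>a <\<^sub>1 \<delta>\<close> implies \<open>a <\<^sub>1 \<alpha>\<close> for every \<open>a \<in> B \<inter> \<alpha>\<close>.  The map \<open>g(0, \<alpha>, \<delta>)\<close> replaces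
  \<open>\<alpha>n + l\<close> by \<open>\<delta>n + l\<close>, so it respects the order and sums.  As only additive principal ordinals have
  \<open><\<^sub>1\<close>-successors, the only instances of \<open><\<^sub>1\<close> in question are those with left-hand side
  \<open>\<alpha>\<close> (resp. \<open>\<delta>\<close>) or below \<open>\<delta>\<close>.  The induction hypothesis yields \<open>\<alpha> \<le>\<^sub>1 b\<close> for all \<open>b \<in> B - \<alpha>\<close>,
  which settles the former, and the latter too, by transitivity.
\<close>

section \<open>Finite multiples and additive principal ordinals\<close>

lemma ordinal_leE:
  fixes a b :: "'a ordinal"
  assumes "a \<le> b"
  obtains s where "b = a + s"
  using left_diff_ex1[OF assms] by blast

lemma ordinal_plus_assoc: "(a + b) + c = a + (b + c :: 'a ordinal)"
proof (induction c rule: less_induct)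
  case (less c)
  show ?case
  proof (rule antisym)
    show "(a + b) + c \<le> a + (b + c)"
    proof (rule plus_le)
      show "a + b \<le> a + (b + c)" using plus_bounds plus_mono_right by blast
      show "a + b + d < a + (b + c)" if "d < c" for d
        using less[OF that] that by (simp add: plus_strict_mono)
    qed
    show "a + (b + c) \<le> (a + b) + c"
    proof (rule plus_le)
      show "a \<le> a + b + c" using plus_bounds[of a b] plus_bounds[of "a + b" c] by force
      fix e assume e: "e < b + c"
      show "a + e < a + b + c"
      proof (cases "e < b")
        case True
        then show ?thesis using plus_strict_mono[of e b a] plus_bounds[of "a + b" c] by force
      next
        case False
        then obtain d where d: "e = b + d" by (meson leI ordinal_leE)
        have "d < c"
          using e plus_mono_right[of c d b] unfolding d by (meson leD leI)
        then show ?thesis using less[of d] plus_strict_mono[of d c "a + b"] by (simp add: d)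
      qed
    qed
  qed
qed

lemma ordinal_zero_plus: "0 + x = (x :: 'a ordinal)"
proof (induction x rule: less_induct)
  case (less x)
  show ?case by (rule antisym[OF plus_le le_plus_right]) (auto simp: less)
qed

lemma osuc_le_osuc: "osuc x \<le> osuc y \<longleftrightarrow> x \<le> y"
  by (meson less_osuc_iff not_less)

text \<open>Indexing the finite multiples by \<open>nat\<close> lets coefficients be handled by
  arithmetic in \<open>nat\<close>; \<open>times_ordinal_of_nat\<close> and
  \<open>less_omegaE\<close> lead back to ordinal products with a factor below
  \<open>omega\<close>.\<close>

fun mult_nat :: "'a ordinal \<Rightarrow> nat \<Rightarrow> 'a ordinal" where
  "mult_nat a 0 = 0"
| "mult_nat a (Suc n) = mult_nat a n + a"

lemma mult_nat_add: "mult_nat a (n + m) = mult_nat a n + mult_nat a m"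
  by (induction m) (simp_all add: plus_zero ordinal_plus_assoc)

lemma mult_nat_mono: "n \<le> m \<Longrightarrow> mult_nat a n \<le> mult_nat a m"
  using mult_nat_add[of a n "m - n"] plus_bounds[of "mult_nat a n"] by simp

definition ordinal_of_nat :: "nat \<Rightarrow> 'a ordinal" where
  "ordinal_of_nat n = (osuc ^^ n) 0"

lemma ordinal_of_nat_simps [simp]:
  "ordinal_of_nat 0 = 0" "ordinal_of_nat (Suc n) = osuc (ordinal_of_nat n)"
  by (simp_all add: ordinal_of_nat_def)

lemma times_ordinal_of_nat: "a * ordinal_of_nat n = mult_nat a n"
  by (induction n) (simp_all add: times_zero times_osuc)

lemma ordinal_of_nat_less_omega: "ordinal_of_nat n < \<omega>"
  using is_limit_omega by (induction n) (auto simp: is_limit_def is_limit_pos)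

lemma one_le_ordinal_of_nat_iff: "1 \<le> (ordinal_of_nat n :: 'a ordinal) \<longleftrightarrow> 0 < n"
proof (cases n)
  case 0
  have "(0 :: 'a ordinal) < 1" using osuc_greater by (simp add: one_ordinal_def)
  then show ?thesis using 0 by (simp add: not_le)
next
  case (Suc m)
  then show ?thesis by (simp add: one_ordinal_def osuc_le_osuc)
qed

text \<open>Since \<open>omega\<close> is the least limit, a nonzero ordinal below it is a
  successor, and induction applies to its predecessor.\<close>

lemma less_omegaE:
  fixes x :: "'a ordinal"
  assumes "x < \<omega>"
  obtains n where "x = ordinal_of_nat n"
proof -
  have "x < \<omega> \<Longrightarrow> \<exists>n. x = ordinal_of_nat n"
  proof (induction x rule: less_induct)
    case (less x)
    show ?case
    proof (cases "x = 0")
      case True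
      then show ?thesis by (metis ordinal_of_nat_simps(1))
    next
      case False
      then obtain y where y: "y < x" "\<not> osuc y < x"
        using not_limit_below_omega[OF less.prems] by (auto simp: is_limit_def)
      then have "x = osuc y" by (simp add: antisym osuc_least leI)
      moreover obtain n where "y = ordinal_of_nat n" using less y by force
      ultimately show ?thesis by (metis ordinal_of_nat_simps(2))
    qed
  qed
  with assms that show thesis by blast
qed

lemma less_times_omega_iff:
  fixes a x :: "'a ordinal"
  shows "x < a * \<omega> \<longleftrightarrow> (\<exists>n. x < mult_nat a n)"
proof
  assume "x < a * \<omega>"
  then have "\<exists>c<\<omega>. x < a * c + a"
    using times_le[of \<omega> a x] by (meson leD leI)
  then obtain c where c: "c < \<omega>" "x < a * c + a" by blast
  then obtain n where "c = ordinal_of_nat n" by (auto elim: less_omegaE)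
  with c show "\<exists>n. x < mult_nat a n"
    by (metis mult_nat.simps(2) times_ordinal_of_nat)
next
  assume "\<exists>n. x < mult_nat a n"
  then show "x < a * \<omega>"
    by (metis less_le_trans less_imp_le ordinal_of_nat_less_omega times_mono_right
        times_ordinal_of_nat)
qed

lemma times_omega_closed_plus:
  assumes "x < a * \<omega>" "y < a * (\<omega> :: 'a ordinal)"
  shows "x + y < a * \<omega>"
proof -
  obtain n m where "x < mult_nat a n" "y < mult_nat a m"
    using assms by (auto simp: less_times_omega_iff)
  then have "x + y < mult_nat a (n + m)"
    unfolding mult_nat_add
    by (meson le_less_trans less_imp_le plus_mono_left plus_strict_mono)
  then show ?thesis by (auto simp: less_times_omega_iff)
qed

section \<open>Additive principal ordinals\<close>

definition add_principal :: "'a ordinal \<Rightarrow> bool" where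
  "add_principal a \<longleftrightarrow> 0 < a \<and> (\<forall>x<a. \<forall>y<a. x + y < a)"

lemma add_principalD: "add_principal a \<Longrightarrow> x < a \<Longrightarrow> y < a \<Longrightarrow> x + y < a"
  unfolding add_principal_def by blast

text \<open>Everything below \<open>omega_pow c\<close> is below some
  \<open>omega_pow d * omega\<close> with \<open>d < c\<close>. Such ordinals are closed under
  addition, and the larger of two exponents serves both summands.\<close>

lemma Class0_add_principal:
  assumes "a \<in> Class0"
  shows "add_principal a"
proof -
  obtain c where a: "a = omega_pow c" and "0 < c" using assms by (auto simp: Class0_def)
  have below: "omega_pow d * \<omega> \<le> a" if "d < c" for d
    using that omega_pow_bounds by (auto simp: a)
  have cover: "\<exists>d<c. x < omega_pow d * \<omega>" if "x < a" for x
  proof (rule ccontr)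
    assume none: "\<not> ?thesis"
    \<comment> \<open>The minimality of \<open>omega_pow c\<close> can only be applied to bounds
      that are at least 1; the exponent 0, available because \<open>0 < c\<close>, supplies
      this.\<close>
    have "(1 :: 'a ordinal) < mult_nat (omega_pow 0) 2"
      by (simp add: numeral_2_eq_2 omega_pow_zero one_ordinal_def ordinal_zero_plus plus_osuc
          plus_zero osuc_greater)
    then have "1 < omega_pow 0 * (\<omega> :: 'a ordinal)" by (auto simp: less_times_omega_iff)
    also have "\<dots> \<le> x" using none \<open>0 < c\<close> by (meson leI)
    finally have "a \<le> x" unfolding a using none by (intro omega_pow_le) (auto dest: leI)
    with that show False by simp
  qed
  have "x + y < a" if xy: "x < a" "y < a" for x y
  proof -
    obtain d e where "d < c" "x < omega_pow d * \<omega>" "e < c" "y < omega_pow e * \<omega>"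
      using cover xy by meson
    moreover define f where "f = max d e"
    ultimately have "f < c" "x < omega_pow f * \<omega>" "y < omega_pow f * \<omega>"
      using times_mono_left[OF omega_pow_mono, of d f \<omega>] times_mono_left[OF omega_pow_mono, of e f \<omega>]
      by (auto intro: less_le_trans)
    then show ?thesis using times_omega_closed_plus below by (meson less_le_trans)
  qed
  moreover have "0 < a"
    using omega_pow_bounds[of c] osuc_greater[of "0 :: 'a ordinal"]
    by (auto simp: a one_ordinal_def intro: less_le_trans)
  ultimately show ?thesis by (simp add: add_principal_def)
qed

lemma add_principal_absorb:
  assumes "add_principal a" "l < a"
  shows "l + a = a"
  using assms by (intro antisym[OF plus_le le_plus_right]) (auto intro: add_principalD)

lemma add_principal_mult_nat_absorb:
  assumes "add_principal a" "l < a" "0 < n"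
  shows "l + mult_nat a n = mult_nat a n"
proof -
  have "mult_nat a n = a + mult_nat a (n - 1)"
    using \<open>0 < n\<close> mult_nat_add[of a 1 "n - 1"] by (simp add: ordinal_zero_plus)
  then show ?thesis
    using add_principal_absorb[OF assms(1,2)] by (simp flip: ordinal_plus_assoc)
qed

lemma add_principal_mult_nat_less:
  assumes "add_principal a" "d < a"
  shows "mult_nat d n < a"
proof (induction n)
  case 0
  show ?case using assms(1) by (simp add: add_principal_def)
next
  case (Suc n)
  show ?case unfolding mult_nat.simps using assms(1) Suc assms(2) by (rule add_principalD)
qed

section \<open>Division with remainder\<close>

lemma times_omega_decomp:
  fixes a x :: "'a ordinal"
  assumes "x < a * \<omega>"
  obtains n l where "x = mult_nat a n + l" "l < a"
proof -
  \<comment> \<open>This n exceeds the quotient by one: it is the first multiple strictly above x,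
    and it is nonzero because nothing lies below 0.\<close>
  define n where "n = (LEAST n. x < mult_nat a n)"
  have n: "x < mult_nat a n"
    unfolding n_def using assms[unfolded less_times_omega_iff] by (rule LeastI_ex)
  then obtain m where m: "n = Suc m" by (cases n) auto
  have "\<not> x < mult_nat a m"
    using not_less_Least[of m "\<lambda>n. x < mult_nat a n"] m by (simp add: n_def)
  then obtain l where l: "x = mult_nat a m + l" by (meson leI ordinal_leE)
  moreover have "l < a"
    using n plus_mono_right[of a l "mult_nat a m"] unfolding m l mult_nat.simps by (meson leD leI)
  ultimately show thesis by (rule that)
qed

lemma mult_nat_plus_less:
  assumes "n < m \<or> n = m \<and> l < k" "l < a"
  shows "mult_nat a n + l < mult_nat a m + k"
  using assms(1)
proof
  assume "n < m"
  then have "mult_nat a (Suc n) \<le> mult_nat a m + k"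
    using mult_nat_mono[of "Suc n" m a] plus_bounds[of "mult_nat a m" k] by force
  then show ?thesis using plus_strict_mono[OF assms(2), of "mult_nat a n"] by simp
qed (auto simp: plus_strict_mono)

text \<open>The right-hand side is lexicographic in quotient and remainder and does not mention
  \<open>a\<close>, so comparisons carry over when \<open>a\<close> is replaced by another ordinal
  above both remainders.\<close>

lemma mult_nat_plus_less_iff:
  assumes "l < a" "k < a"
  shows "mult_nat a n + l < mult_nat a m + k \<longleftrightarrow> n < m \<or> n = m \<and> l < k"
proof (intro iffI mult_nat_plus_less[OF _ assms(1)])
  assume less: "mult_nat a n + l < mult_nat a m + k"
  have "\<not> (m < n \<or> m = n \<and> k < l)"
    using mult_nat_plus_less[OF _ assms(2), of m n l] less by auto
  moreover have "\<not> (n = m \<and> l = k)" using less by auto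
  ultimately show "n < m \<or> n = m \<and> l < k" by force
qed

lemma mult_nat_plus_eq_iff:
  assumes "l < a" "k < a"
  shows "mult_nat a n + l = mult_nat a m + k \<longleftrightarrow> n = m \<and> l = k"
proof
  assume eq: "mult_nat a n + l = mult_nat a m + k"
  have "\<not> (n < m \<or> n = m \<and> l < k)" "\<not> (m < n \<or> m = n \<and> k < l)"
    using mult_nat_plus_less[OF _ assms(1), of n m k] mult_nat_plus_less[OF _ assms(2), of m n l] eq
    by auto
  then show "n = m \<and> l = k" by force
qed simp

lemma mult_nat_plus_less_times_omega:
  assumes "l < a"
  shows "mult_nat a n + l < a * \<omega>"
  unfolding less_times_omega_iff
  by (rule exI[of _ "Suc n"]) (simp add: assms plus_strict_mono)

lemma le_mult_nat_plus:
  assumes "0 < n"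
  shows "a \<le> mult_nat a n + l"
proof -
  have "a \<le> mult_nat a n" using mult_nat_mono[of 1 n a] assms by (simp add: ordinal_zero_plus)
  then show ?thesis using plus_bounds[of "mult_nat a n" l] by (auto intro: order_trans)
qed

text \<open>A leading copy of \<open>a\<close> in the second summand absorbs \<open>l\<close>. The
  resulting rule has the same shape for every additive principal \<open>a\<close>, which is why
  replacing \<alpha> by \<delta> respects sums.\<close>

lemma add_principal_plus:
  assumes "add_principal a" "l < a"
  shows "(mult_nat a n + l) + (mult_nat a m + k) =
    (if m = 0 then mult_nat a n + (l + k) else mult_nat a (n + m) + k)"
proof (cases "m = 0")
  case True
  then show ?thesis by (simp add: ordinal_zero_plus ordinal_plus_assoc)
next
  case False
  then have "l + mult_nat a m = mult_nat a m" using add_principal_mult_nat_absorb[OF assms] by simp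
  then have "l + (mult_nat a m + k) = mult_nat a m + k" by (metis ordinal_plus_assoc)
  with False show ?thesis by (simp add: mult_nat_add ordinal_plus_assoc)
qed

section \<open>The maps g and the sets T in terms of quotient and remainder\<close>

lemma g_up_mult_nat:
  assumes "l < a"
  shows "g_up a c (mult_nat a n + l) = mult_nat c n + l"
\<comment> \<open>The identity branch of \<open>g_up\<close> is the instance n = 0 of the same
  formula, so later arguments need no separate case.\<close>
proof (cases "n = 0")
  case True
  then show ?thesis using assms by (simp add: g_up_def ordinal_zero_plus)
next
  case False
  then have ge: "\<not> mult_nat a n + l < a" using le_mult_nat_plus[of n a l] by (simp add: not_less)
  have "(THE y. \<exists>N L. 1 \<le> N \<and> N < \<omega> \<and> L < a \<and> mult_nat a n + l = a * N + L \<and> y = c * N + L)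
      = mult_nat c n + l"
  proof (rule the_equality)
    show "\<exists>N L. 1 \<le> N \<and> N < \<omega> \<and> L < a \<and> mult_nat a n + l = a * N + L
        \<and> mult_nat c n + l = c * N + L"
      using False assms
      by (intro exI[of _ "ordinal_of_nat n"] exI[of _ l])
        (simp add: one_le_ordinal_of_nat_iff ordinal_of_nat_less_omega times_ordinal_of_nat)
  next
    fix y
    assume "\<exists>N L. 1 \<le> N \<and> N < \<omega> \<and> L < a \<and> mult_nat a n + l = a * N + L \<and> y = c * N + L"
    then obtain N L where *: "N < \<omega>" "L < a" "mult_nat a n + l = a * N + L" "y = c * N + L"
      by blast
    obtain m where "N = ordinal_of_nat m" using *(1) by (rule less_omegaE)
    with * assms show "y = mult_nat c n + l"
      by (simp add: times_ordinal_of_nat mult_nat_plus_eq_iff)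
  qed
  with ge show ?thesis by (simp add: g_up_def)
qed

text \<open>For \<open>l < d\<close> the argument is the image of \<open>mult_nat d n + l\<close>
  under \<open>g_up d a\<close>, which is injective because quotient and remainder are
  unique.\<close>

lemma g0_mult_nat:
  assumes "d < a" "l < d"
  shows "g0 a d (mult_nat a n + l) = mult_nat d n + l"
proof -
  have inj: "inj_on (g_up d a) {..<d * \<omega>}"
  proof (rule inj_onI)
    fix x y assume "x \<in> {..<d * \<omega>}" "y \<in> {..<d * \<omega>}" and eq: "g_up d a x = g_up d a y"
    then obtain n l m k where "x = mult_nat d n + l" "l < d" "y = mult_nat d m + k" "k < d"
      by (auto elim!: times_omega_decomp)
    moreover from this have "l < a" "k < a" using assms by auto
    ultimately show "x = y" using eq by (simp add: g_up_mult_nat mult_nat_plus_eq_iff)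
  qed
  have "inv_into {..<d * \<omega>} (g_up d a) (g_up d a (mult_nat d n + l)) = mult_nat d n + l"
    using inj assms by (intro inv_into_f_f) (auto intro: mult_nat_plus_less_times_omega)
  then show ?thesis using assms by (simp add: g0_def g_up_mult_nat)
qed

text \<open>Turns the domain conditions on T into bounds on remainders.\<close>

lemma T0_mult_nat:
  assumes "l < a"
  shows "T0 a (mult_nat a n + l) \<inter> {..<a} = {l}"
proof (cases "n = 0")
  case True
  then show ?thesis using assms by (simp add: T0_def ordinal_zero_plus)
next
  case False
  define t where "t = mult_nat a n + l"
  have diff: "left_diff (mult_nat a n) t = l"
    unfolding left_diff_def t_def
    by (rule the1_equality[OF left_diff_ex1]) (use plus_bounds in blast)+
  have ge: "\<not> t < a" using False le_mult_nat_plus[of n a l] by (simp add: t_def not_less)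
  have "{left_diff (a * N) t | N. 1 \<le> N \<and> N < \<omega> \<and> t \<in> {a * N..<a * N + a}} = {l}"
  proof (rule antisym; rule subsetI)
    fix y assume "y \<in> {left_diff (a * N) t | N. 1 \<le> N \<and> N < \<omega> \<and> t \<in> {a * N..<a * N + a}}"
    then obtain N where N: "y = left_diff (a * N) t" "N < \<omega>" "a * N \<le> t" "t < a * N + a"
      by auto
    obtain m where m: "N = ordinal_of_nat m" using N(2) by (rule less_omegaE)
    obtain k where k: "t = mult_nat a m + k"
      using N(3) unfolding m times_ordinal_of_nat by (rule ordinal_leE)
    have "k < a"
      using N(4) plus_mono_right[of a k "mult_nat a m"] unfolding k m times_ordinal_of_nat
      by (meson leD leI)
    then have "m = n" using assms k by (simp add: t_def mult_nat_plus_eq_iff)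
    then show "y \<in> {l}" using N(1) m diff by (simp add: times_ordinal_of_nat)
  next
    fix y assume "y \<in> {l}"
    then show "y \<in> {left_diff (a * N) t | N. 1 \<le> N \<and> N < \<omega> \<and> t \<in> {a * N..<a * N + a}}"
      using False assms diff plus_bounds[of "mult_nat a n" l]
      by (auto intro!: exI[of _ "ordinal_of_nat n"] plus_strict_mono
          simp: one_le_ordinal_of_nat_iff ordinal_of_nat_less_omega times_ordinal_of_nat t_def)
  qed
  then show ?thesis using ge assms unfolding t_def[symmetric] by (auto simp: T0_def)
qed

section \<open>The relations\<close>

lemma ord_iso_comp:
  assumes "ord_iso R h Z Z'" "ord_iso R h' Z' Z''"
  shows "ord_iso R (h' \<circ> h) Z Z''"
proof -
  have in_Z': "h x \<in> Z'" if "x \<in> Z" for x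
    using that assms(1) by (auto simp: ord_iso_def dest: bij_betwE)
  then show ?thesis
    using assms unfolding ord_iso_def by (auto intro: bij_betw_trans)
qed

lemma less1_less: "a <\<^sub>1 b \<Longrightarrow> a < b"
  by (subst (asm) less1.simps) blast

lemma less1D:
  assumes "a <\<^sub>1 b" "finite Z" "Z \<subseteq> {..<b}"
  shows "\<exists>Z' h. Z' \<subseteq> {..<a} \<and> finite Z' \<and> ord_iso (<\<^sub>1) h Z Z' \<and> (\<forall>x \<in> Z \<inter> {..<a}. h x = x)"
  using assms(1)[unfolded less1.simps[of a b]] assms(2,3) by blast

lemma less1I:
  assumes "a < b"
    and "\<And>Z. finite Z \<Longrightarrow> Z \<subseteq> {..<b} \<Longrightarrow> \<exists>Z' h. Z' \<subseteq> {..<a} \<and> finite Z' \<and> ord_iso (<\<^sub>1) h Z Z' \<and>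
      (\<forall>x \<in> Z \<inter> {..<a}. h x = x)"
  shows "a <\<^sub>1 b"
  unfolding less1.simps[of a b] using assms by blast

text \<open>A finite subset of \<open>b\<close> is also a finite subset of \<open>c\<close>.\<close>

lemma less1_mono:
  assumes "a <\<^sub>1 c" "a < b" "b \<le> c"
  shows "a <\<^sub>1 b"
proof (rule less1I[OF assms(2)])
  fix Z assume "finite Z" "Z \<subseteq> {..<b}"
  then show "\<exists>Z' h. Z' \<subseteq> {..<a} \<and> finite Z' \<and> ord_iso (<\<^sub>1) h Z Z' \<and> (\<forall>x \<in> Z \<inter> {..<a}. h x = x)"
    using assms(3) by (intro less1D[OF assms(1)]) auto
qed

text \<open>The two isomorphisms compose. A point of \<open>Z\<close> below \<open>a\<close> is
  fixed by the first, hence lies in \<open>Z'\<close> and is fixed by the second.\<close>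

lemma less1_trans:
  assumes "a <\<^sub>1 b" "b <\<^sub>1 c"
  shows "a <\<^sub>1 c"
proof (rule less1I)
  have "a < b" "b < c" using assms by (auto dest: less1_less)
  then show "a < c" by simp
  fix Z assume Z: "finite Z" "Z \<subseteq> {..<c}"
  obtain Z' h where Z': "Z' \<subseteq> {..<b}" "finite Z'" and h: "ord_iso (<\<^sub>1) h Z Z'"
    and hid: "\<forall>x \<in> Z \<inter> {..<b}. h x = x"
    using less1D[OF assms(2) Z] by blast
  obtain Z'' h' where Z'': "Z'' \<subseteq> {..<a}" "finite Z''" and h': "ord_iso (<\<^sub>1) h' Z' Z''"
    and h'id: "\<forall>x \<in> Z' \<inter> {..<a}. h' x = x"
    using less1D[OF assms(1) Z'(2,1)] by blast
  have "h x \<in> Z'" if "x \<in> Z" for x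
    using that h by (auto simp: ord_iso_def dest: bij_betwE)
  then have "(h' \<circ> h) x = x" if "x \<in> Z" "x < a" for x
    using that \<open>a < b\<close> hid h'id by force
  then show "\<exists>Z' h. Z' \<subseteq> {..<a} \<and> finite Z' \<and> ord_iso (<\<^sub>1) h Z Z' \<and> (\<forall>x \<in> Z \<inter> {..<a}. h x = x)"
    using Z'' ord_iso_comp[OF h h'] by (metis IntE lessThan_iff)
qed

text \<open>Reflecting \<open>{x, y, x + y}\<close> below \<open>x + y\<close> would fix both
  summands, hence also their sum, which cannot lie below itself.\<close>

lemma not_less1_sum:
  fixes x y :: "'a ordinal"
  assumes "x < x + y" "y < x + y"
  shows "\<not> x + y <\<^sub>1 b"
proof
  assume less1: "x + y <\<^sub>1 b"
  then have sub: "{x, y, x + y} \<subseteq> {..<b}" using assms by (auto dest: less1_less)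
  obtain Z h where Z: "Z \<subseteq> {..<x + y}" and h: "ord_iso (<\<^sub>1) h {x, y, x + y} Z"
    and hid: "\<forall>z \<in> {x, y, x + y} \<inter> {..<x + y}. h z = z"
    using less1D[OF less1 _ sub] by blast
  have "h (x + y) = h x + h y" using h by (simp add: ord_iso_def)
  also have "\<dots> = x + y" using hid assms by simp
  finally have "h (x + y) = x + y" .
  moreover have "h (x + y) \<in> Z" using h by (auto simp: ord_iso_def dest: bij_betwE)
  ultimately show False using Z by auto
qed

text \<open>In all other cases the left-hand side is a sum of two smaller ordinals:
  \<open>mult_nat a n\<close> and \<open>l\<close> if \<open>l\<close> is nonzero, otherwise
  \<open>mult_nat a (n - 1)\<close> and \<open>a\<close>.\<close>

lemma less1_mult_natD:
  fixes a :: "'a ordinal"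
  assumes "0 < n" "l < a" "mult_nat a n + l <\<^sub>1 b"
  shows "n = 1 \<and> l = 0"
proof -
  have "0 < a" using assms(2) by (rule le_less_trans[OF ordinal_zero_le])
  have "l = 0"
  proof (rule ccontr)
    assume "l \<noteq> 0"
    then have "0 < l" using ordinal_zero_le[of l] by order
    then have "mult_nat a n < mult_nat a n + l"
      using plus_strict_mono[of 0 l "mult_nat a n"] by (simp add: plus_zero)
    moreover have "l < mult_nat a n + l"
      using le_mult_nat_plus[OF assms(1), of a l] assms(2) by order
    ultimately show False using not_less1_sum assms(3) by blast
  qed
  moreover have "n = 1"
  proof (rule ccontr)
    assume "n \<noteq> 1"
    then obtain m where m: "n = Suc m" "0 < m" using assms(1) by (cases n) auto
    have "mult_nat a m < mult_nat a m + a"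
      using plus_strict_mono[OF \<open>0 < a\<close>, of "mult_nat a m"] by (simp add: plus_zero)
    moreover have "a < mult_nat a m + a"
      using le_mult_nat_plus[OF \<open>0 < m\<close>, of a 0] calculation by (simp add: plus_zero)
    ultimately show False
      using not_less1_sum[of "mult_nat a m" a b] assms(3) \<open>l = 0\<close> m by (simp add: plus_zero)
  qed
  ultimately show ?thesis by simp
qed

text \<open>The map \<open>g0 a d\<close> is itself the required isomorphism: its values
  \<open>mult_nat d n + l\<close> stay below the additive principal \<open>a\<close>.\<close>

lemma less0_imp_less1:
  fixes a t :: "'a ordinal"
  assumes "a <\<^sup>0 t" "a \<in> Class0" "t \<le> a * \<omega>"
  shows "a <\<^sub>1 t"
proof (rule less1I)
  show "a < t" using assms(1) by (simp add: less0_def)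
  fix Z assume Z: "finite Z" "Z \<subseteq> {..<t}"
  then obtain d where d: "d \<in> Class0" "d < a" "(\<Union>q\<in>Z. T0 a q) \<inter> {..<a} \<subseteq> {..<d}"
    and iso: "ord_iso (<\<^sub>1) (g0 a d) Z (g0 a d ` Z)" "\<forall>x \<in> Z \<inter> {..<a}. g0 a d x = x"
    using assms(1) unfolding less0_def by auto
  have princ: "add_principal a" using assms(2) by (rule Class0_add_principal)
  have "g0 a d x < a" if x: "x \<in> Z" for x
  proof -
    have "x < a * \<omega>" using x Z assms(3) by auto
    then obtain n l where nl: "x = mult_nat a n + l" "l < a" by (rule times_omega_decomp)
    then have "l < d" using d(3) T0_mult_nat[of l a n] x by auto
    then show ?thesis
      using add_principalD[OF princ add_principal_mult_nat_less[OF princ d(2), of n] nl(2)] nl d(2)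
      by (simp add: g0_mult_nat)
  qed
  then show "\<exists>Z' h. Z' \<subseteq> {..<a} \<and> finite Z' \<and> ord_iso (<\<^sub>1) h Z Z' \<and> (\<forall>x \<in> Z \<inter> {..<a}. h x = x)"
    using iso Z(1) by (intro exI[of _ "g0 a d ` Z"] exI[of _ "g0 a d"]) auto
qed

section \<open>Bounds for the choice of \<delta>\<close>

lemma finite_below_bound:
  fixes a :: "'a ordinal"
  assumes "finite X" "X \<subseteq> {..<a}" "0 < a"
  obtains z where "z < a" "\<And>x. x \<in> X \<Longrightarrow> x \<le> z"
proof
  \<comment> \<open>Inserting 0 covers the case of empty \<open>X\<close>.\<close>
  show "Max (insert 0 X) < a" using assms by auto
  show "\<And>x. x \<in> X \<Longrightarrow> x \<le> Max (insert 0 X)" using assms by simp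
qed

text \<open>A finite set that witnesses the failure at \<open>c\<close> is bounded by some
  \<open>z < c\<close>, and it witnesses the failure at every \<open>b\<close> above
  \<open>z\<close>.\<close>

lemma not_less1_bound:
  assumes "a < c" "\<not> a <\<^sub>1 c"
  obtains z where "z < c" "\<And>b. z < b \<Longrightarrow> \<not> a <\<^sub>1 b"
proof -
  obtain Z where Z: "finite Z" "Z \<subseteq> {..<c}"
    and none: "\<not> (\<exists>Z' h. Z' \<subseteq> {..<a} \<and> finite Z' \<and> ord_iso (<\<^sub>1) h Z Z' \<and>
      (\<forall>x \<in> Z \<inter> {..<a}. h x = x))"
    using assms(2)[unfolded less1.simps[of a c]] assms(1) by auto
  have "0 < c" using assms(1) by (rule le_less_trans[OF ordinal_zero_le])
  then obtain z where z: "z < c" "\<And>x. x \<in> Z \<Longrightarrow> x \<le> z" using finite_below_bound Z by blast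
  show thesis
  proof (rule that[OF z(1)])
    fix b assume "z < b"
    then have "Z \<subseteq> {..<b}" using z by force
    then show "\<not> a <\<^sub>1 b"
      using none less1D[OF _ Z(1)] by metis
  qed
qed

lemma Lim_pts_unbounded:
  fixes a :: "'a ordinal"
  assumes "a \<in> Lim_pts A" "z < a"
  obtains b where "b \<in> A" "z < b" "b < a"
proof -
  have "z < (LEAST x. \<forall>b\<in>A \<inter> {..<a}. b \<le> x)"
    using assms by (auto simp: Lim_pts_def Sup_ordinal_def)
  then have "\<not> (\<forall>b\<in>A \<inter> {..<a}. b \<le> z)" by (rule not_less_Least)
  with that show thesis by (auto simp: not_le)
qed

text \<open>The map keeps quotient and remainder, which determine order and sums; only the
  preservation of \<open>R\<close> has to be assumed.\<close>

lemma g0_ord_iso: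
  fixes \<alpha> \<delta> :: "'a ordinal"
  assumes "add_principal \<alpha>" "add_principal \<delta>" "\<delta> < \<alpha>"
    and dom: "\<And>x. x \<in> B \<Longrightarrow> \<exists>n l. x = mult_nat \<alpha> n + l \<and> l < \<delta>"
    and R: "\<And>x y. x \<in> B \<Longrightarrow> y \<in> B \<Longrightarrow> R x y \<longleftrightarrow> R (g0 \<alpha> \<delta> x) (g0 \<alpha> \<delta> y)"
  shows "ord_iso R (g0 \<alpha> \<delta>) B (g0 \<alpha> \<delta> ` B)"
proof -
  \<comment> \<open>The full domain of the map. It is closed under addition, and injectivity on it
    reflects membership of sums in \<open>B\<close> even when \<open>x + y\<close> lies outside
    \<open>B\<close>.\<close>
  define D where "D = {mult_nat \<alpha> n + l | n l. l < \<delta>}"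
  have BD: "B \<subseteq> D" using dom by (fastforce simp: D_def)
  have less: "x < y \<longleftrightarrow> g0 \<alpha> \<delta> x < g0 \<alpha> \<delta> y" if xy: "x \<in> D" "y \<in> D" for x y
  proof -
    obtain n l m k where "x = mult_nat \<alpha> n + l" "l < \<delta>" "y = mult_nat \<alpha> m + k" "k < \<delta>"
      using xy by (auto simp: D_def)
    moreover from this have "l < \<alpha>" "k < \<alpha>" using assms(3) by auto
    ultimately show ?thesis using assms(3) by (simp add: g0_mult_nat mult_nat_plus_less_iff)
  qed
  have inj: "inj_on (g0 \<alpha> \<delta>) D"
    by (rule inj_onI) (metis less less_irrefl linorder_less_linear)
  have plus: "x + y \<in> D \<and> g0 \<alpha> \<delta> (x + y) = g0 \<alpha> \<delta> x + g0 \<alpha> \<delta> y" if xy: "x \<in> D" "y \<in> D" for x y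
  proof -
    obtain n l m k where *: "x = mult_nat \<alpha> n + l" "l < \<delta>" "y = mult_nat \<alpha> m + k" "k < \<delta>"
      using xy by (auto simp: D_def)
    then have "l < \<alpha>" using assms(3) by simp
    have "l + k < \<delta>" using assms(2) *(2,4) by (rule add_principalD)
    have sum: "x + y = (if m = 0 then mult_nat \<alpha> n + (l + k) else mult_nat \<alpha> (n + m) + k)"
      unfolding *(1,3) by (rule add_principal_plus[OF assms(1) \<open>l < \<alpha>\<close>])
    show ?thesis
    proof
      show "x + y \<in> D" unfolding sum D_def using \<open>k < \<delta>\<close> \<open>l + k < \<delta>\<close> by auto
      have "g0 \<alpha> \<delta> x + g0 \<alpha> \<delta> y = (mult_nat \<delta> n + l) + (mult_nat \<delta> m + k)"
        using * assms(3) by (simp add: g0_mult_nat)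
      then show "g0 \<alpha> \<delta> (x + y) = g0 \<alpha> \<delta> x + g0 \<alpha> \<delta> y"
        unfolding sum add_principal_plus[OF assms(2) \<open>l < \<delta>\<close>]
        using \<open>k < \<delta>\<close> \<open>l + k < \<delta>\<close> assms(3) by (simp add: g0_mult_nat)
    qed
  qed
  show ?thesis
    unfolding ord_iso_def
  proof (intro conjI ballI)
    show "bij_betw (g0 \<alpha> \<delta>) B (g0 \<alpha> \<delta> ` B)"
      using inj BD by (simp add: bij_betw_def inj_on_subset)
    fix x y assume xy: "x \<in> B" "y \<in> B"
    then have D: "x \<in> D" "y \<in> D" using BD by auto
    show "x < y \<longleftrightarrow> g0 \<alpha> \<delta> x < g0 \<alpha> \<delta> y" using less D by blast
    show "R x y \<longleftrightarrow> R (g0 \<alpha> \<delta> x) (g0 \<alpha> \<delta> y)" using R xy by blast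
    show "x + y \<in> B \<longleftrightarrow> g0 \<alpha> \<delta> x + g0 \<alpha> \<delta> y \<in> g0 \<alpha> \<delta> ` B"
      using plus[OF D] inj_on_image_mem_iff[OF inj _ BD, of "x + y"] by metis
    show "x + y \<in> B \<longrightarrow> g0 \<alpha> \<delta> (x + y) = g0 \<alpha> \<delta> x + g0 \<alpha> \<delta> y" using plus D by blast
  qed
qed

section \<open>Induction along the interval from \<alpha> to t + 1\<close>

theorem proposition13:
  fixes \<alpha> t :: "'a ordinal"
  assumes "\<alpha> \<in> Class0"
    and "t \<in> {\<alpha>..<\<alpha> * \<omega>}"
    and "\<alpha> \<in> Lim_pts {\<beta> \<in> Class0. T0 \<alpha> t \<inter> {..<\<alpha>} \<subseteq> {..<\<beta>} \<and> \<beta> \<le>\<^sub>1 g0 \<alpha> \<beta> t}"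
  shows "\<alpha> <\<^sup>0 t + 1"
proof -
  have princ: "add_principal \<alpha>" using assms(1) by (rule Class0_add_principal)
  then have pos: "0 < \<alpha>" by (simp add: add_principal_def)
  obtain p r where t: "t = mult_nat \<alpha> p + r" and r: "r < \<alpha>"
    using assms(2) by (auto elim: times_omega_decomp)
  have T0_t: "T0 \<alpha> t \<inter> {..<\<alpha>} = {r}" using r by (simp add: t T0_mult_nat)
  have "\<alpha> <\<^sup>0 u" if "\<alpha> < u" "u \<le> t + 1" for u
    using that
  proof (induction u rule: less_induct)
    case (less u)
    have below_u: "x \<le> t" if "x < u" for x
      using less.prems that by (auto simp: plus_one less_osuc_iff dest: less_le_trans)
    have below_omega: "x < \<alpha> * \<omega>" if "x < u" for x
      using below_u[OF that] assms(2) by auto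
    \<comment> \<open>Elements of \<open>B\<close> are strictly below u, so the induction hypothesis
      reaches every one of them above \<alpha>.\<close>
    have le1: "\<alpha> \<le>\<^sub>1 b" if "\<alpha> \<le> b" "b < u" for b
    proof (cases "\<alpha> = b")
      case False
      then have "\<alpha> <\<^sup>0 b" using that less by (intro less.IH) auto
      then have "\<alpha> <\<^sub>1 b"
        using assms(1) below_omega[OF that(2)] by (intro less0_imp_less1) auto
      then show ?thesis by (simp add: le1_def)
    qed (simp add: le1_def)
    show ?case
      unfolding less0_def
    proof (intro conjI allI impI less.prems)
      fix B assume B: "finite B \<and> B \<subseteq> {..<u}"
      have "\<forall>x. \<exists>n l. x \<in> B \<longrightarrow> x = mult_nat \<alpha> n + l \<and> l < \<alpha>"
        using B below_omega by (meson lessThan_iff subsetD times_omega_decomp)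
      then obtain quo rem where decomp:
        "\<And>x. x \<in> B \<Longrightarrow> x = mult_nat \<alpha> (quo x) + rem x" "\<And>x. x \<in> B \<Longrightarrow> rem x < \<alpha>"
        by metis
      \<comment> \<open>The bound is chosen for all \<open>a\<close> at once; where there is no
        failure to record, 0 will do.\<close>
      have "\<forall>a. \<exists>z. z < \<alpha> \<and> (a < \<alpha> \<longrightarrow> \<not> a <\<^sub>1 \<alpha> \<longrightarrow> (\<forall>b>z. \<not> a <\<^sub>1 b))"
        using not_less1_bound pos by metis
      then obtain zf where zf: "\<And>a. zf a < \<alpha>"
        "\<And>a b. a < \<alpha> \<Longrightarrow> \<not> a <\<^sub>1 \<alpha> \<Longrightarrow> zf a < b \<Longrightarrow> \<not> a <\<^sub>1 b"
        by metis
      obtain z where z: "z < \<alpha>" "\<And>x. x \<in> rem ` B \<union> zf ` B \<Longrightarrow> x \<le> z"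
        by (rule finite_below_bound[OF _ _ pos, of "rem ` B \<union> zf ` B"]) (use B decomp zf in auto)
      \<comment> \<open>By \<open>T0_t\<close> the condition on T becomes
        \<open>r < \<delta>\<close>, so that the value of g at t can be computed.\<close>
      obtain \<delta> where \<delta>: "\<delta> \<in> Class0" "r < \<delta>" "\<delta> \<le>\<^sub>1 g0 \<alpha> \<delta> t" "z < \<delta>" "\<delta> < \<alpha>"
        using Lim_pts_unbounded[OF assms(3) z(1)] T0_t
        by (metis (lifting) insert_subset lessThan_iff mem_Collect_eq)
      have princ_\<delta>: "add_principal \<delta>" using \<delta>(1) by (rule Class0_add_principal)
      have rem: "rem x < \<delta>" if "x \<in> B" for x using z(2) \<delta>(4) that by (auto intro: le_less_trans)
      \<comment> \<open>If \<open>a <\<^sub>1 \<alpha>\<close> failed, it would fail with every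
        ordinal above \<open>zf a\<close> in place of \<alpha>, in particular with \<delta>.\<close>
      have reflect: "a <\<^sub>1 \<alpha>" if "a \<in> B" "a < \<alpha>" "a <\<^sub>1 \<delta>" for a
        using zf(2)[of a \<delta>] z(2)[of "zf a"] \<delta>(4) that by (auto intro: le_less_trans)
      have h: "g0 \<alpha> \<delta> x = mult_nat \<delta> (quo x) + rem x" if "x \<in> B" for x
        using g0_mult_nat[OF \<delta>(5) rem[OF that], of "quo x"] decomp(1)[OF that] by simp
      have quo0: "quo x = 0 \<longleftrightarrow> x < \<alpha>" if "x \<in> B" for x
        using decomp[OF that] le_mult_nat_plus[of "quo x" \<alpha> "rem x"]
        by (metis leD neq0_conv mult_nat.simps(1) ordinal_zero_plus)
      have fix_below: "g0 \<alpha> \<delta> x = x \<and> x < \<delta>" if "x \<in> B" "x < \<alpha>" for x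
        using h[OF that(1)] rem[OF that(1)] decomp(1)[OF that(1)] quo0[OF that(1)] that(2)
        by (simp add: ordinal_zero_plus)
      have ge_\<delta>: "\<delta> \<le> g0 \<alpha> \<delta> x" if "x \<in> B" "\<alpha> \<le> x" for x
        using h[OF that(1)] quo0[OF that(1)] that(2) le_mult_nat_plus[of "quo x"] by auto
      \<comment> \<open>Needed to pass from the assumption on the value at t down to the values at
        elements of \<open>B\<close>.\<close>
      have h_le: "g0 \<alpha> \<delta> x \<le> g0 \<alpha> \<delta> t" if "x \<in> B" for x
      proof -
        have "\<not> t < x" using below_u[of x] B that by auto
        then have "\<not> (p < quo x \<or> p = quo x \<and> r < rem x)"
          using decomp[OF that] mult_nat_plus_less[of p "quo x" r "rem x" \<alpha>] r by (metis t)
        then have "\<not> mult_nat \<delta> p + r < mult_nat \<delta> (quo x) + rem x"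
          using rem[OF that] \<delta>(2) by (simp add: mult_nat_plus_less_iff)
        then show ?thesis using h[OF that] \<delta>(2,5) by (simp add: t g0_mult_nat not_less)
      qed
      have R: "a <\<^sub>1 b \<longleftrightarrow> g0 \<alpha> \<delta> a <\<^sub>1 g0 \<alpha> \<delta> b" if ab: "a \<in> B" "b \<in> B" for a b
      proof (cases "b < \<alpha>")
        case b_less: True
        show ?thesis
        proof (cases "a < \<alpha>")
          case True
          then show ?thesis using fix_below ab b_less by metis
        next
          case False
          then have "b < a" "g0 \<alpha> \<delta> b < g0 \<alpha> \<delta> a"
            using b_less fix_below[OF ab(2)] ge_\<delta>[OF ab(1)] by (auto intro: less_le_trans)
          then show ?thesis by (meson less1_less less_asym)
        qed
      next
        case b_ge: False
        have "b < u" using B ab by auto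
        then have \<alpha>b: "\<alpha> \<le>\<^sub>1 b" using le1 b_ge by auto
        have \<delta>b: "\<delta> \<le> g0 \<alpha> \<delta> b" using ge_\<delta>[OF ab(2)] b_ge by auto
        show ?thesis
        proof (cases "a < \<alpha>")
          case True
          note a = fix_below[OF ab(1) True]
          show ?thesis
          proof
            assume "a <\<^sub>1 b"
            \<comment> \<open>The map never increases an element of \<open>B\<close>, so
              \<open>less1_mono\<close> moves the right-hand side from b down to its image.\<close>
            moreover have "g0 \<alpha> \<delta> b \<le> b"
            proof -
              have "mult_nat \<delta> n \<le> mult_nat \<alpha> n" for n
              proof (induction n)
                case (Suc n)
                have "mult_nat \<delta> n + \<delta> \<le> mult_nat \<alpha> n + \<delta>" using Suc by (rule plus_mono_left)
                also have "\<dots> \<le> mult_nat \<alpha> n + \<alpha>" using \<delta>(5) by (intro plus_mono_right) simp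
                finally show ?case by simp
              qed simp
              then have "mult_nat \<delta> (quo b) + rem b \<le> mult_nat \<alpha> (quo b) + rem b"
                by (rule plus_mono_left)
              then show ?thesis using h[OF ab(2)] decomp(1)[OF ab(2)] by simp
            qed
            ultimately show "g0 \<alpha> \<delta> a <\<^sub>1 g0 \<alpha> \<delta> b"
              using a \<delta>b by (auto intro: less1_mono less_le_trans)
          next
            assume "g0 \<alpha> \<delta> a <\<^sub>1 g0 \<alpha> \<delta> b"
            \<comment> \<open>Descend from the image of b to \<delta>, pass from \<delta> to
              \<alpha> by \<open>reflect\<close>, then climb from \<alpha> to b by
              transitivity.\<close>
            then have "a <\<^sub>1 \<delta>" using a \<delta>b by (auto intro: less1_mono)
            then have "a <\<^sub>1 \<alpha>" using reflect ab(1) True by blast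
            then show "a <\<^sub>1 b" using \<alpha>b by (auto simp: le1_def intro: less1_trans)
          qed
        next
          case False
          \<comment> \<open>From here on either relation forces a to be \<alpha> with image
            \<delta>, by \<open>less1_mult_natD\<close> applied to multiples of \<alpha> or of
            \<delta>.\<close>
          then have quo_a: "0 < quo a" using quo0 ab by blast
          show ?thesis
          proof
            assume less1: "a <\<^sub>1 b"
            then have "quo a = 1 \<and> rem a = 0"
              using less1_mult_natD[OF quo_a decomp(2)] decomp(1) ab(1) by metis
            then have "a = \<alpha>" "g0 \<alpha> \<delta> a = \<delta>"
              using decomp(1)[OF ab(1)] h[OF ab(1)] by (simp_all add: plus_zero ordinal_zero_plus)
            moreover have "\<delta> < g0 \<alpha> \<delta> b"
            proof -
              have "mult_nat \<alpha> (quo a) + rem a < mult_nat \<alpha> (quo b) + rem b"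
                using less1_less[OF less1] decomp(1) ab by metis
              then have "g0 \<alpha> \<delta> a < g0 \<alpha> \<delta> b"
                using ab decomp(2) rem by (simp add: h mult_nat_plus_less_iff)
              then show ?thesis using \<open>g0 \<alpha> \<delta> a = \<delta>\<close> by simp
            qed
            \<comment> \<open>The image of b lies strictly above \<delta> and at most at the image
              of t, so \<open>less1_mono\<close> applies to
              \<open>\<delta> \<le>\<^sub>1 g0 \<alpha> \<delta> t\<close>.\<close>
            ultimately show "g0 \<alpha> \<delta> a <\<^sub>1 g0 \<alpha> \<delta> b"
              using \<delta>(3) h_le[OF ab(2)] by (auto simp: le1_def intro: less1_mono)
          next
            assume less1: "g0 \<alpha> \<delta> a <\<^sub>1 g0 \<alpha> \<delta> b"
            then have "quo a = 1 \<and> rem a = 0"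
              using less1_mult_natD[OF quo_a rem] h ab(1) by metis
            then have "a = \<alpha>" "g0 \<alpha> \<delta> a = \<delta>"
              using decomp(1)[OF ab(1)] h[OF ab(1)] by (simp_all add: plus_zero ordinal_zero_plus)
            moreover have "a \<noteq> b" using less1_less[OF less1] by auto
            ultimately show "a <\<^sub>1 b" using \<alpha>b by (simp add: le1_def)
          qed
        qed
      qed
      show "\<exists>\<delta>\<in>Class0 \<inter> {..<\<alpha>}. (\<Union>q\<in>B. T0 \<alpha> q) \<inter> {..<\<alpha>} \<subseteq> {..<\<delta>} \<and>
          ord_iso (<\<^sub>1) (g0 \<alpha> \<delta>) B (g0 \<alpha> \<delta> ` B) \<and> (\<forall>x\<in>B \<inter> {..<\<alpha>}. g0 \<alpha> \<delta> x = x)"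
      proof (intro bexI[of _ \<delta>] conjI)
        have "T0 \<alpha> q \<inter> {..<\<alpha>} \<subseteq> {..<\<delta>}" if "q \<in> B" for q
          using T0_mult_nat[OF decomp(2)[OF that], of "quo q"] decomp(1)[OF that] rem[OF that] by simp
        then show "(\<Union>q\<in>B. T0 \<alpha> q) \<inter> {..<\<alpha>} \<subseteq> {..<\<delta>}" by blast
        show "ord_iso (<\<^sub>1) (g0 \<alpha> \<delta>) B (g0 \<alpha> \<delta> ` B)"
          using decomp(1) rem by (intro g0_ord_iso princ princ_\<delta> \<delta>(5) R) auto
        show "\<forall>x\<in>B \<inter> {..<\<alpha>}. g0 \<alpha> \<delta> x = x" using fix_below by blast
        show "\<delta> \<in> Class0 \<inter> {..<\<alpha>}" using \<delta> by simp
      qed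
    qed
  qed
  moreover have "\<alpha> < t + 1" using assms(2) by (simp add: plus_one less_osuc_iff)
  ultimately show ?thesis by blast
qed

end
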